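(* Let $(a_m)_{m\geqslant 0}$ and $(b_m)_{m\geqslant 0}$ be complex sequences with $a_0 = b_0 = 1$, with exponential generating series $$f(x)=\sum_{m=0}^{+\infty}\frac{a_m}{m!} \, x^m, \qquad g(x)=\sum_{m=0}^{+\infty}\frac{b_m}{m!} \, x^m .$$ For $x \in \mathbb{C}$, define the infinite lower-triangular matrices $A(x) = (A_{n,k}(x))_{n,k \geqslant 1}$ and $B(x) = (B_{n,k}(x))_{n,k \geqslant 1}$ by $$ A_{n,k}(x) = (-1)^k \binom{n}{k}\sum_{m=0}^{n-k}\frac{(k-n)_m \, a_m}{m!} \, x^m, \qquad B_{n,k}(x) = (-1)^k \binom{n}{k}\sum_{m=0}^{n-k}\frac{(k-n)_m \, b_m}{m!} \, x^m $$ for $1 \leqslant k \leqslant n$ (and zero for $k>n$). Then the matrices $A(x)$ and $B(x)$ are inverse of each other (for all $x \in \mathbb{C}$) if and only if $$ [x^{n-k}]\, f(-x)g(x)=\delta(n-k) \qquad \text{for all } 1 \leqslant k \leqslant n . $$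
   Context: $(c)_m$ denotes the Pochhammer symbol, $(c)_0=1$ and $(c)_m = c(c+1)\cdots(c+m-1)$ for $m \geqslant 1$. $f$ and $g$ are formal power series; $[x^j]h(x)$ denotes the coefficient of $x^j$ in the power series $h(x)$. $\delta(0)=1$ and $\delta(j)=0$ for $j\neq 0$. *)

theory Defs
  imports
    "HOL-Computational_Algebra.Formal_Power_Series"
    "HOL-Analysis.Infinite_Sum"
begin

(* Infinite matrices are functions of two natural numbers of which only the
   entries with both indices >= 1 are meaningful; the notions below never look
   at index 0.  For the lower-triangular matrices considered here the sum in the
   product has only finitely many nonzero terms. *)

type_synonym inf_matrix = "nat \<Rightarrow> nat \<Rightarrow> complex"

definition inf_matrix_mult :: "inf_matrix \<Rightarrow> inf_matrix \<Rightarrow> inf_matrix" where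
  "inf_matrix_mult M N n k = (\<Sum>\<^sub>\<infinity>l\<in>{1..}. M n l * N l k)"

definition is_identity_matrix :: "inf_matrix \<Rightarrow> bool" where
  "is_identity_matrix M \<longleftrightarrow> (\<forall>n\<ge>1. \<forall>k\<ge>1. M n k = (if n = k then 1 else 0))"

definition inverse_matrices :: "inf_matrix \<Rightarrow> inf_matrix \<Rightarrow> bool" where
  "inverse_matrices M N \<longleftrightarrow>
     is_identity_matrix (inf_matrix_mult M N) \<and> is_identity_matrix (inf_matrix_mult N M)"

definition binomial_matrix :: "(nat \<Rightarrow> complex) \<Rightarrow> complex \<Rightarrow> inf_matrix" where
  "binomial_matrix a x n k =
     (if k \<le> n
      then (- 1) ^ k * of_nat (n choose k) *
             (\<Sum>m = 0..n - k. pochhammer (of_nat k - of_nat n) m * a m / fact m * x ^ m)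
      else 0)"

definition exp_gen_fun :: "(nat \<Rightarrow> complex) \<Rightarrow> complex fps" where
  "exp_gen_fun a = Abs_fps (\<lambda>m. a m / fact m)"

definition delta :: "nat \<Rightarrow> complex" where
  "delta j = (if j = 0 then 1 else 0)"

end

theory Submission
  imports Defs
begin

text \<open>
  The factorials hidden in the binomial coefficients and Pochhammer symbols turn
  the matrix entries into coefficients of a power series in \<open>t\<close>:
  \<open>A\<^sub>n\<^sub>k(x) = (-1)^k (n!/k!) [t^(n-k)] e^t f(-xt)\<close>, and likewise for \<open>B\<close> and \<open>g\<close>
  (lemma \<open>binomial_matrix_eq_coeff\<close>). In the product of the two matrices the
  sign \<open>(-1)^(l+k) = (-1)^(l-k)\<close> is absorbed by replacing \<open>t\<close> with \<open>-t\<close> in the second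
  series, and the sum over the middle index \<open>l\<close> is then a Cauchy product. The factors
  \<open>e^t\<close> and \<open>e^(-t)\<close> cancel, so that
  \<open>(A(x) B(x))\<^sub>n\<^sub>k = (n!/k!) x^(n-k) [t^(n-k)] f(-t) g(t)\<close>
  (lemma \<open>mult_binomial_matrix\<close>). At \<open>x = 1\<close> this determines every coefficient of
  \<open>f(-t) g(t)\<close>; conversely, if these coefficients are those of \<open>1\<close>, the product is the
  identity for every \<open>x\<close>. The product \<open>B(x) A(x)\<close> leads to \<open>g(-t) f(t)\<close>, which is
  \<open>f(-t) g(t)\<close> with \<open>t\<close> replaced by \<open>-t\<close> and hence gives the same conditions.
\<close>

lemma fps_nth_compose_scale:
  "fps_nth (fps_compose F (fps_const c * fps_X)) n = c ^ n * fps_nth F n"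
  for c :: "'a :: comm_ring_1"
  by (simp add: fps_compose_linear)

lemma fps_nth_compose_uminus_X:
  "fps_nth (fps_compose F (- fps_X)) n = (- 1) ^ n * fps_nth F n"
  for F :: "'a :: comm_ring_1 fps"
  using fps_nth_compose_scale[of F "- 1" n] by (simp flip: fps_const_neg)

lemma pochhammer_uminus_of_nat:
  assumes "m \<le> d"
  shows "pochhammer (- of_nat d) m = (- 1) ^ m * fact d / (fact (d - m) :: 'a :: field_char_0)"
proof -
  have "pochhammer (- of_nat d) m = (- 1) ^ m * (fact m * of_nat (d choose m) :: 'a)"
    by (simp add: binomial_gbinomial gbinomial_pochhammer flip: power_mult_distrib mult.assoc)
  with assms show ?thesis
    by (simp add: binomial_fact)
qed

text \<open>Since \<open>(-d)\<^sub>m = (-1)^m d!/(d-m)!\<close> with \<open>d = n - k\<close>, the summand for \<open>m\<close> is \<open>d!\<close>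
  times the coefficient of \<open>t^m\<close> in \<open>f(-xt)\<close> times the coefficient of \<open>t^(d-m)\<close> in
  \<open>e^t\<close>, so that the sum is a Cauchy product.\<close>

lemma binomial_matrix_eq_coeff:
  assumes "k \<le> n"
  shows "binomial_matrix a x n k = (- 1) ^ k * (fact n / fact k) *
    fps_nth (fps_compose (exp_gen_fun a) (fps_const (- x) * fps_X) * fps_exp 1) (n - k)"
proof -
  have "(\<Sum>m = 0..n - k. pochhammer (of_nat k - of_nat n) m * a m / fact m * x ^ m)
      = (\<Sum>m = 0..n - k. fact (n - k) *
          ((- x) ^ m * (a m / fact m) * (1 / fact (n - k - m))))"
  proof (rule sum.cong)
    fix m assume "m \<in> {0..n - k}"
    moreover have "of_nat k - of_nat n = - (of_nat (n - k) :: complex)"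
      using assms by (simp add: of_nat_diff)
    ultimately show "pochhammer (of_nat k - of_nat n) m * a m / fact m * x ^ m
        = fact (n - k) * ((- x) ^ m * (a m / fact m) * (1 / fact (n - k - m)))"
      by (simp add: pochhammer_uminus_of_nat power_minus[of x] mult_ac)
  qed simp
  also have "\<dots> = fact (n - k) *
      fps_nth (fps_compose (exp_gen_fun a) (fps_const (- x) * fps_X) * fps_exp 1) (n - k)"
    unfolding fps_mult_nth sum_distrib_left
    by (simp only: fps_nth_compose_scale) (simp add: exp_gen_fun_def)
  finally show ?thesis
    using assms by (simp add: binomial_matrix_def binomial_fact)
qed

lemma inf_matrix_mult_lower_triangular:
  assumes "\<And>n l. n < l \<Longrightarrow> M n l = 0" and "\<And>l k. l < k \<Longrightarrow> N l k = 0" and "1 \<le> k"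
  shows "inf_matrix_mult M N n k = (\<Sum>l = k..n. M n l * N l k)"
proof -
  have "inf_matrix_mult M N n k = (\<Sum>\<^sub>\<infinity>l\<in>{k..n}. M n l * N l k)"
    unfolding inf_matrix_mult_def
  proof (rule infsum_cong_neutral)
    fix l assume "l \<in> {1..} - {k..n}"
    then have "n < l \<or> l < k" by auto
    then show "M n l * N l k = 0" using assms by auto
  qed (use assms(3) in auto)
  then show ?thesis by simp
qed

lemma binomial_matrix_above_diagonal: "n < k \<Longrightarrow> binomial_matrix a x n k = 0"
  by (simp add: binomial_matrix_def)

text \<open>The factorials \<open>n!/l!\<close> and \<open>l!/k!\<close> telescope, which leaves a convolution over the
  middle index; \<open>x\<close> enters the resulting series only through the scaling \<open>t \<mapsto> xt\<close>, which
  accounts for the power \<open>x^(n-k)\<close>.\<close>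

lemma mult_binomial_matrix:
  assumes "1 \<le> k" and "k \<le> n"
  shows "inf_matrix_mult (binomial_matrix a x) (binomial_matrix b x) n k =
    fact n / fact k * x ^ (n - k) *
    fps_nth (fps_compose (exp_gen_fun a) (- fps_X) * exp_gen_fun b) (n - k)"
proof -
  define F where "F = fps_compose (exp_gen_fun a) (fps_const (- x) * fps_X)"
  define G where "G = fps_compose (exp_gen_fun b) (fps_const (- x) * fps_X)"
  define H where "H = fps_compose (exp_gen_fun b) (fps_const x * fps_X)"
  \<comment> \<open>The substitution of \<open>-t\<close> for \<open>t\<close> turns \<open>e^t g(-xt)\<close> into \<open>e^(-t) g(xt)\<close>.\<close>
  have reflect: "(- 1) ^ j * fps_nth (G * fps_exp 1) j = fps_nth (H * fps_exp (- 1)) j" for j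
  proof -
    have "fps_nth (fps_compose (G * fps_exp 1) (fps_const (- 1) * fps_X)) j
        = fps_nth (H * fps_exp (- 1)) j"
    proof -
      have "fps_compose G (fps_const (- 1) * fps_X) = H"
        unfolding G_def H_def
        by (rule fps_ext, simp only: fps_nth_compose_scale) (simp flip: mult.assoc power_mult_distrib)
      moreover have "fps_compose (fps_exp 1) (fps_const (- 1) * fps_X) = fps_exp (- 1 :: complex)"
        by (rule fps_ext, simp only: fps_nth_compose_scale) simp
      ultimately show ?thesis
        by (simp add: fps_compose_mult_distrib)
    qed
    then show ?thesis
      by (simp only: fps_nth_compose_scale)
  qed
  have "inf_matrix_mult (binomial_matrix a x) (binomial_matrix b x) n k
      = (\<Sum>l = k..n. binomial_matrix a x n l * binomial_matrix b x l k)"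
    using assms(1) by (intro inf_matrix_mult_lower_triangular binomial_matrix_above_diagonal)
  also have "\<dots> = (\<Sum>l = k..n. fact n / fact k *
      (fps_nth (F * fps_exp 1) (n - l) * fps_nth (H * fps_exp (- 1)) (l - k)))"
  proof (rule sum.cong)
    fix l assume "l \<in> {k..n}"
    then have l: "k \<le> l" "l \<le> n" by auto
    have sign: "(- 1) ^ l * (- 1) ^ k = (- 1 :: complex) ^ (l - k)"
      using l by (simp add: uminus_power_if)
    have "binomial_matrix a x n l * binomial_matrix b x l k
        = fact n / fact k * (fps_nth (F * fps_exp 1) (n - l) *
          (((- 1) ^ l * (- 1) ^ k) * fps_nth (G * fps_exp 1) (l - k)))"
      using l by (simp add: binomial_matrix_eq_coeff F_def G_def)
    then show "binomial_matrix a x n l * binomial_matrix b x l k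
        = fact n / fact k * (fps_nth (F * fps_exp 1) (n - l) * fps_nth (H * fps_exp (- 1)) (l - k))"
      by (simp only: sign reflect)
  qed simp
  also have "\<dots> = fact n / fact k *
      (\<Sum>j = 0..n - k. fps_nth (F * fps_exp 1) (n - k - j) * fps_nth (H * fps_exp (- 1)) j)"
    unfolding sum_distrib_left
    by (rule sum.reindex_bij_witness[of _ "\<lambda>j. j + k" "\<lambda>l. l - k"]) (use assms in auto)
  also have "\<dots> = fact n / fact k * fps_nth ((H * fps_exp (- 1)) * (F * fps_exp 1)) (n - k)"
    unfolding fps_mult_nth[of "H * fps_exp (- 1)"] by (simp only: mult.commute)
  also have "(H * fps_exp (- 1)) * (F * fps_exp 1) = F * H * (fps_exp (- 1) * fps_exp 1)"
    by (simp only: mult_ac)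
  also have "\<dots> = F * H"
    by (simp flip: fps_exp_add_mult)
  also have "F * H
      = fps_compose (fps_compose (exp_gen_fun a) (- fps_X) * exp_gen_fun b) (fps_const x * fps_X)"
  proof -
    have "F = fps_compose (fps_compose (exp_gen_fun a) (- fps_X)) (fps_const x * fps_X)"
      unfolding F_def
      by (rule fps_ext, simp only: fps_nth_compose_scale fps_nth_compose_uminus_X)
        (simp add: power_minus[of x])
    then show ?thesis
      by (simp add: H_def fps_compose_mult_distrib)
  qed
  finally show ?thesis
    by (simp only: fps_nth_compose_scale mult.assoc)
qed

lemma is_identity_mult_binomial_matrix_iff:
  "(\<forall>x. is_identity_matrix (inf_matrix_mult (binomial_matrix a x) (binomial_matrix b x))) \<longleftrightarrow>
   fps_compose (exp_gen_fun a) (- fps_X) * exp_gen_fun b = 1" (is "?L \<longleftrightarrow> ?P = 1")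
proof
  assume ?L
  then have id: "is_identity_matrix (inf_matrix_mult (binomial_matrix a 1) (binomial_matrix b 1))"
    by blast
  show "?P = 1"
  proof (rule fps_ext)
    fix j
    \<comment> \<open>The first column already contains all coefficients.\<close>
    have "fact (Suc j) * fps_nth ?P j = (if j = 0 then 1 else 0)"
      using id mult_binomial_matrix[of 1 "Suc j" a 1 b]
      by (auto simp: is_identity_matrix_def simp del: fact_Suc)
    then show "fps_nth ?P j = fps_nth 1 j"
      by (cases j) (simp_all del: fact_Suc)
  qed
next
  assume P: "?P = 1"
  have "inf_matrix_mult (binomial_matrix a x) (binomial_matrix b x) n k = (if n = k then 1 else 0)"
    if "1 \<le> k" for x n k
  proof (cases "k \<le> n")
    case True
    with that show ?thesis by (simp add: mult_binomial_matrix P)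
  next
    case False
    with that show ?thesis
      by (simp add: inf_matrix_mult_lower_triangular binomial_matrix_above_diagonal)
  qed
  then show ?L
    by (simp add: is_identity_matrix_def)
qed

text \<open>Both sides of the second equation arise from those of the first by the
  involutive substitution \<open>t \<mapsto> -t\<close>.\<close>

lemma fps_reflect_mult_eq_1_commute:
  fixes F G :: "'a :: idom fps"
  shows "fps_compose F (- fps_X) * G = 1 \<longleftrightarrow> fps_compose G (- fps_X) * F = 1"
proof -
  have invol: "fps_compose (fps_compose F (- fps_X)) (- fps_X) = F" for F :: "'a fps"
    by (rule fps_ext) (simp add: fps_nth_compose_uminus_X flip: mult.assoc power_mult_distrib)
  have "fps_compose G (- fps_X) * F = 1"
    if "fps_compose F (- fps_X) * G = 1" for F G :: "'a fps"
  proof -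
    have "F * fps_compose G (- fps_X) = fps_compose (fps_compose F (- fps_X) * G) (- fps_X)"
      by (simp add: fps_compose_mult_distrib invol)
    with that show ?thesis by (simp add: mult.commute)
  qed
  then show ?thesis by blast
qed

theorem proposition2p1:
  fixes a b :: "nat \<Rightarrow> complex"
  assumes "a 0 = 1" and "b 0 = 1"
  shows "(\<forall>x. inverse_matrices (binomial_matrix a x) (binomial_matrix b x)) \<longleftrightarrow>
         (\<forall>n k. 1 \<le> k \<and> k \<le> n \<longrightarrow>
            fps_nth (fps_compose (exp_gen_fun a) (- fps_X) * exp_gen_fun b) (n - k) = delta (n - k))"
proof -
  let ?P = "fps_compose (exp_gen_fun a) (- fps_X) * exp_gen_fun b"
  have "(\<forall>x. inverse_matrices (binomial_matrix a x) (binomial_matrix b x)) \<longleftrightarrow> ?P = 1"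
    unfolding inverse_matrices_def all_conj_distrib is_identity_mult_binomial_matrix_iff
    using fps_reflect_mult_eq_1_commute by blast
  also have "\<dots> \<longleftrightarrow> (\<forall>j. fps_nth ?P j = delta j)"
    by (simp add: fps_eq_iff delta_def)
  also have "\<dots> \<longleftrightarrow> (\<forall>n k. 1 \<le> k \<and> k \<le> n \<longrightarrow> fps_nth ?P (n - k) = delta (n - k))"
  proof (intro iffI allI impI)
    fix j
    assume "\<forall>n k. 1 \<le> k \<and> k \<le> n \<longrightarrow> fps_nth ?P (n - k) = delta (n - k)"
    then have "fps_nth ?P (Suc j - 1) = delta (Suc j - 1)"
      by (metis le_refl One_nat_def Suc_le_mono le0)
    then show "fps_nth ?P j = delta j" by simp
  qed blast
  finally show ?thesis .
qed

end
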